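(* Consider a John elastic material with rigidity parameter $k>0$ whose underlying fluid has the linear equation of state $p_0=(\Gamma-1)\rho_0$ with $1<\Gamma\le 2$, i.e. $\hat\rho_0(n)=a n^\Gamma$ and $\hat p_0(n)=a(\Gamma-1)n^\Gamma$ for some constant $a>0$. Let $(x,y,m)$ be a regular ball solution with radius $R>0$ and ADM mass $M>0$, and let $\rho(r)=\hat\rho(x(r),y(r))$. Then $x(R)>0$, or equivalently $\rho(R)>0$, if and only if $\Gamma,k$ satisfy one of the following two conditions: \begin{itemize} \item[(i)] $1<\Gamma<5/3$; \item[(ii)] $\Gamma\ge 5/3$ and $k>1/3$. \end{itemize} Moreover, the mass and the radius of regular ball solutions with $\rho(R)>0$ satisfy the inequality $$\frac{2M}{R}\ge\frac{6(\Gamma-1)}{6\Gamma-5}.$$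
   Context: John elastic material. Given $k\ge 0$ (the rigidity parameter) and a function $\hat\rho_0$ of $n\ge 0$, let $\hat p_0(n)=n^2\frac{d}{dn}\big(\hat\rho_0(n)/n\big)$; the pair $(\hat\rho_0,\hat p_0)$ is called the underlying fluid. With $n=y\sqrt{x}$ and $x,y\geq 0$, set $$\hat\rho(x,y)=\hat\rho_0(n)\Big[1+k\Big(\frac{x+2y}{n^{2/3}}-3\Big)\Big],$$ $$\hat p_{\mathrm{rad}}(x,y)=\hat p_0(n)\Big[1+k\Big(\frac{x+2y}{n^{2/3}}-3\Big)\Big]+\hat\rho_0(n)\frac{4k(x-y)}{3n^{2/3}},$$ $$\hat p_{\mathrm{tan}}(x,y)=\hat p_0(n)\Big[1+k\Big(\frac{x+2y}{n^{2/3}}-3\Big)\Big]-\hat\rho_0(n)\frac{2k(x-y)}{3n^{2/3}},$$ these functions being equal to $0$ when $x=0$ or $y=0$. The system. For radial functions $x(r),y(r),m(r)$ (prime denotes $d/dr$; $\hat\rho,\hat p_{\mathrm{rad}},\hat p_{\mathrm{tan}}$ and their partial derivatives are evaluated at $(x(r),y(r))$): $$x'=\frac{1}{\partial_x\hat p_{\mathrm{rad}}}\Big[-(\hat p_{\mathrm{rad}}+\hat\rho)\frac{m+r^3\hat p_{\mathrm{rad}}/2}{r(r-2m)}+\frac{2}{r}(\hat p_{\mathrm{tan}}-\hat p_{\mathrm{rad}})-y'\,\partial_y\hat p_{\mathrm{rad}}\Big],$$ $$y'=\frac{2}{r}\Big(\sqrt{\frac{r}{r-2m}\,xy}-y\Big),\qquad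 m'=\frac12 r^2\hat\rho.$$ Regular ball solution. A triple $(x,y,m)$ of radial functions is called a regular ball solution of this system with radius $R>0$ and ADM mass $M>0$ if: (i) $x,y,m\in C^1([0,R])$ (meaning $C^1$ on $(0,R)$, with the functions and their derivatives extending continuously to the boundary; $x(R),y(R)$ are the values of these extensions); (ii) $x(0)=y(0)=:h>0$ and $m(0)=0$; (iii) $x,y>0$ for $r\in[0,R)$, and $0<2m(r)<r$ for all $r>0$; (iv) for $r>R$, $x=y=0$ and $m=m(R)=:M$; (v) $p_{\mathrm{rad}}(r):=\hat p_{\mathrm{rad}}(x(r),y(r))$ satisfies $p_{\mathrm{rad}}(r)>0$ for $r\in[0,R)$ and $p_{\mathrm{rad}}(R)=0$; (vi) $(x,y,m)$ solves the system for $r\in(0,R)$. *)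

theory Defs
  imports "HOL-Analysis.Analysis"
begin

text \<open>
  The reference density \<open>\<rho>0\<close> of the underlying fluid is a function of the particle density
  \<open>n \<ge> 0\<close>; its values at negative arguments are irrelevant. It is meant to be smooth for
  \<open>n > 0\<close>, so that the derivatives taken with \<^const>\<open>deriv\<close> below exist wherever they are used.
\<close>

definition fluid_pressure :: "(real \<Rightarrow> real) \<Rightarrow> real \<Rightarrow> real" where
  "fluid_pressure \<rho>0 n = n\<^sup>2 * deriv (\<lambda>\<nu>. \<rho>0 \<nu> / \<nu>) n"

definition particle_density :: "real \<Rightarrow> real \<Rightarrow> real" where
  "particle_density x y = y * sqrt x"

definition john_factor :: "real \<Rightarrow> real \<Rightarrow> real \<Rightarrow> real" where
  "john_factor k x y = 1 + k * ((x + 2 * y) / particle_density x y powr (2/3) - 3)"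

definition john_density :: "real \<Rightarrow> (real \<Rightarrow> real) \<Rightarrow> real \<Rightarrow> real \<Rightarrow> real" where
  "john_density k \<rho>0 x y =
    (if x = 0 \<or> y = 0 then 0
     else \<rho>0 (particle_density x y) * john_factor k x y)"

definition john_prad :: "real \<Rightarrow> (real \<Rightarrow> real) \<Rightarrow> real \<Rightarrow> real \<Rightarrow> real" where
  "john_prad k \<rho>0 x y =
    (if x = 0 \<or> y = 0 then 0
     else fluid_pressure \<rho>0 (particle_density x y) * john_factor k x y
          + \<rho>0 (particle_density x y)
            * (4 * k * (x - y) / (3 * particle_density x y powr (2/3))))"

definition john_ptan :: "real \<Rightarrow> (real \<Rightarrow> real) \<Rightarrow> real \<Rightarrow> real \<Rightarrow> real" where
  "john_ptan k \<rho>0 x y =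
    (if x = 0 \<or> y = 0 then 0
     else fluid_pressure \<rho>0 (particle_density x y) * john_factor k x y
          - \<rho>0 (particle_density x y)
            * (2 * k * (x - y) / (3 * particle_density x y powr (2/3))))"

definition john_prad_dx :: "real \<Rightarrow> (real \<Rightarrow> real) \<Rightarrow> real \<Rightarrow> real \<Rightarrow> real" where
  "john_prad_dx k \<rho>0 x y = deriv (\<lambda>s. john_prad k \<rho>0 s y) x"

definition john_prad_dy :: "real \<Rightarrow> (real \<Rightarrow> real) \<Rightarrow> real \<Rightarrow> real \<Rightarrow> real" where
  "john_prad_dy k \<rho>0 x y = deriv (\<lambda>s. john_prad k \<rho>0 x s) y"

text \<open>
  \<open>C\<^sup>1\<close> on the open interval, with the function and its derivative extending continuously to the
  end points. The values \<open>f a\<close> and \<open>f b\<close> are required to be those of the extension, whatever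
  \<open>f\<close> does outside \<open>{a..b}\<close>.
\<close>

definition C1_closed :: "(real \<Rightarrow> real) \<Rightarrow> real \<Rightarrow> real \<Rightarrow> bool" where
  "C1_closed f a b \<longleftrightarrow>
    continuous_on {a..b} f \<and>
    (\<exists>f'. continuous_on {a..b} f' \<and>
          (\<forall>r\<in>{a<..<b}. (f has_real_derivative f' r) (at r)))"

text \<open>
  The right-hand side of the first equation has the denominator \<open>\<partial>\<^sub>x p\<^sub>r\<^sub>a\<^sub>d\<close>, which has to be
  nonzero for the system to make sense; since division is total in HOL, this is stated explicitly.
\<close>

definition solves_john_system ::
  "real \<Rightarrow> (real \<Rightarrow> real) \<Rightarrow> (real \<Rightarrow> real) \<Rightarrow> (real \<Rightarrow> real) \<Rightarrow> (real \<Rightarrow> real) \<Rightarrow> real set \<Rightarrow> bool"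
where
  "solves_john_system k \<rho>0 x y m I \<longleftrightarrow>
    (\<forall>r\<in>I.
      john_prad_dx k \<rho>0 (x r) (y r) \<noteq> 0 \<and>
      (x has_real_derivative
         1 / john_prad_dx k \<rho>0 (x r) (y r) *
         (- (john_prad k \<rho>0 (x r) (y r) + john_density k \<rho>0 (x r) (y r))
             * ((m r + r ^ 3 * john_prad k \<rho>0 (x r) (y r) / 2) / (r * (r - 2 * m r)))
          + 2 / r * (john_ptan k \<rho>0 (x r) (y r) - john_prad k \<rho>0 (x r) (y r))
          - deriv y r * john_prad_dy k \<rho>0 (x r) (y r))) (at r) \<and>
      (y has_real_derivative
         2 / r * (sqrt (r / (r - 2 * m r) * (x r * y r)) - y r)) (at r) \<and>
      (m has_real_derivative
         1 / 2 * r\<^sup>2 * john_density k \<rho>0 (x r) (y r)) (at r))"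

definition regular_ball_solution ::
  "real \<Rightarrow> (real \<Rightarrow> real) \<Rightarrow> (real \<Rightarrow> real) \<Rightarrow> (real \<Rightarrow> real) \<Rightarrow> (real \<Rightarrow> real) \<Rightarrow> real \<Rightarrow> real \<Rightarrow> bool"
where
  "regular_ball_solution k \<rho>0 x y m R M \<longleftrightarrow>
    R > 0 \<and> M > 0 \<and>
    C1_closed x 0 R \<and> C1_closed y 0 R \<and> C1_closed m 0 R \<and>
    x 0 = y 0 \<and> x 0 > 0 \<and> m 0 = 0 \<and>
    (\<forall>r\<in>{0..<R}. x r > 0 \<and> y r > 0) \<and>
    (\<forall>r>0. 0 < 2 * m r \<and> 2 * m r < r) \<and>
    (\<forall>r>R. x r = 0 \<and> y r = 0 \<and> m r = M) \<and> m R = M \<and>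
    (\<forall>r\<in>{0..<R}. john_prad k \<rho>0 (x r) (y r) > 0) \<and>
    john_prad k \<rho>0 (x R) (y R) = 0 \<and>
    solves_john_system k \<rho>0 x y m {0<..<R}"

definition linear_fluid :: "(real \<Rightarrow> real) \<Rightarrow> real \<Rightarrow> real \<Rightarrow> bool" where
  "linear_fluid \<rho>0 a \<Gamma> \<longleftrightarrow> (\<forall>n\<ge>0. \<rho>0 n = a * n powr \<Gamma>)"

text \<open>
  The pressure law of the linear equation of state need not be assumed separately.
\<close>

lemma linear_fluid_pressure:
  assumes "linear_fluid \<rho>0 a \<Gamma>" and "n \<ge> 0"
  shows "fluid_pressure \<rho>0 n = a * (\<Gamma> - 1) * n powr \<Gamma>"
    and "fluid_pressure \<rho>0 n = (\<Gamma> - 1) * \<rho>0 n"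
proof -
  show *: "fluid_pressure \<rho>0 n = a * (\<Gamma> - 1) * n powr \<Gamma>"
  proof (cases "n = 0")
    case True
    then show ?thesis by (simp add: fluid_pressure_def)
  next
    case False
    with assms have n: "n > 0" by simp
    have "((\<lambda>\<nu>. a * \<nu> powr (\<Gamma> - 1)) has_real_derivative
            a * ((\<Gamma> - 1) * n powr (\<Gamma> - 1 - 1))) (at n)"
      using n by (auto intro!: derivative_eq_intros)
    note deriv_pow = this
    have "eventually (\<lambda>\<nu>. \<nu> \<in> {0<..}) (nhds n)"
      using n by (intro eventually_nhds_in_open) auto
    then have ev: "eventually (\<lambda>\<nu>. a * \<nu> powr (\<Gamma> - 1) = \<rho>0 \<nu> / \<nu>) (nhds n)"
      by eventually_elim (use assms(1) in \<open>auto simp: linear_fluid_def powr_diff\<close>)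
    have "((\<lambda>\<nu>. \<rho>0 \<nu> / \<nu>) has_real_derivative
            a * ((\<Gamma> - 1) * n powr (\<Gamma> - 1 - 1))) (at n)"
      using DERIV_cong_ev[OF refl ev refl] deriv_pow by simp
    then have "deriv (\<lambda>\<nu>. \<rho>0 \<nu> / \<nu>) n = a * ((\<Gamma> - 1) * n powr (\<Gamma> - 1 - 1))"
      by (rule DERIV_imp_deriv)
    then show ?thesis
      using n by (simp add: fluid_pressure_def powr_diff power2_eq_square)
  qed
  then show "fluid_pressure \<rho>0 n = (\<Gamma> - 1) * \<rho>0 n"
    using assms by (simp add: linear_fluid_def)
qed

end

theory Submission
  imports Defs
begin

text \<open>
  Write \<open>n = y \<surd>x\<close>, \<open>\<rho> = a n\<^bsup>\<Gamma> - 2/3\<^esup> D\<close> and \<open>p = a n\<^bsup>\<Gamma> - 2/3\<^esup> B\<close>, where \<open>B\<close> and \<open>D\<close> are continuous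
  up to \<open>x = 0\<close>. Since \<open>r\<^sup>2 y\<close> is nondecreasing, \<open>y(R) > 0\<close>. If \<open>x(R) > 0\<close>, then \<open>B(R) = 0\<close>, which
  is impossible for \<open>\<Gamma> \<ge> 5/3\<close> and \<open>k \<le> 1/3\<close>; moreover \<open>p\<^sub>t\<^sub>a\<^sub>n = 3 (\<Gamma> - 1) \<rho> / 2\<close> at \<open>R\<close>, and
  \<open>p'(R) \<le> 0\<close> becomes \<open>M / (R - 2 M) \<ge> 3 (\<Gamma> - 1)\<close>. If \<open>x(R) = 0\<close>, then \<open>B\<close> tends to
  \<open>2 k (\<Gamma> - 5/3) y(R)\<close>, so \<open>\<Gamma> < 5/3\<close> contradicts \<open>p > 0\<close>. For \<open>\<Gamma> > 5/3\<close> a Gronwall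
  estimate \<open>p' \<ge> - K p\<close> contradicts \<open>p(R) = 0\<close>, and for \<open>\<Gamma> = 5/3\<close> the next order of \<open>B\<close>,
  which has the sign of \<open>1 - 3 k\<close>, forces \<open>k \<le> 1/3\<close>.
\<close>

section \<open>Calculus: chain rule and a one-sided Gronwall estimate\<close>

text \<open>Joint differentiability makes both one-variable \<open>deriv\<close>s values of a single
  linear map \<open>L\<close>.\<close>

lemma partial_derivs_chain:
  fixes f :: "real \<Rightarrow> real \<Rightarrow> real"
  assumes f: "(\<lambda>z. f (fst z) (snd z)) differentiable (at (x r, y r))"
    and x: "(x has_real_derivative x') (at r)"
    and y: "(y has_real_derivative y') (at r)"
  shows "((\<lambda>r. f (x r) (y r)) has_real_derivative
      x' * deriv (\<lambda>s. f s (y r)) (x r) + y' * deriv (\<lambda>s. f (x r) s) (y r)) (at r)"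
proof -
  obtain L where L: "((\<lambda>z. f (fst z) (snd z)) has_derivative L) (at (x r, y r))"
    using f by (auto simp: differentiable_def)
  \<comment> \<open>Used three times: for the two coordinate lines through the point and for the
    trajectory itself.\<close>
  have curve: "((\<lambda>s. f (u s) (v s)) has_real_derivative L (u', v')) (at t)"
    if u: "(u has_real_derivative u') (at t)" and v: "(v has_real_derivative v') (at t)"
      and uv: "u t = x r" "v t = y r" for u v u' v' t
  proof -
    have "((\<lambda>s. (u s, v s)) has_derivative (\<lambda>h. (u' * h, v' * h))) (at t)"
      using u v by (intro has_derivative_Pair) (auto simp: has_field_derivative_def)
    from has_derivative_compose[OF this] L uv
    have "((\<lambda>s. f (u s) (v s)) has_derivative (\<lambda>h. L (u' * h, v' * h))) (at t)"
      by fastforce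
    moreover have "L (u' * h, v' * h) = L (u', v') * h" for h
      using linear_cmul[OF has_derivative_linear[OF L], of h "(u', v')"] by (simp add: mult.commute)
    ultimately show ?thesis by (simp add: has_field_derivative_def)
  qed
  have "deriv (\<lambda>s. f s (y r)) (x r) = L (1, 0)" "deriv (\<lambda>s. f (x r) s) (y r) = L (0, 1)"
    by (rule DERIV_imp_deriv, rule curve; simp)+
  moreover have "L (x', y') = x' * L (1, 0) + y' * L (0, 1)"
    using linear_add[OF has_derivative_linear[OF L], of "x' *\<^sub>R (1, 0)" "y' *\<^sub>R (0, 1)"]
      linear_cmul[OF has_derivative_linear[OF L], of x' "(1, 0)"]
      linear_cmul[OF has_derivative_linear[OF L], of y' "(0, 1)"] by simp
  ultimately show ?thesis using curve[OF x y] by simp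
qed

text \<open>The differential inequality makes \<open>f r * exp (C * r)\<close> nondecreasing near
  \<open>R\<close>, so its value at \<open>R\<close> is at least a positive earlier one.\<close>

lemma positive_at_right_end:
  fixes f :: "real \<Rightarrow> real"
  assumes "A < R" "continuous_on {A..R} f"
    and "\<forall>\<^sub>F r in at_left R. f r > 0 \<and> (f has_real_derivative f' r) (at r) \<and> f' r \<ge> - C * f r"
  shows "f R > 0"
proof -
  obtain b where "b < R" and b: "\<And>r. b < r \<Longrightarrow> r < R \<Longrightarrow>
      f r > 0 \<and> (f has_real_derivative f' r) (at r) \<and> f' r \<ge> - C * f r"
    using assms(3) by (auto simp: eventually_at_left_field)
  define c where "c = (max A b + R) / 2"
  have c: "A < c" "b < c" "c < R" using \<open>A < R\<close> \<open>b < R\<close> by (auto simp: c_def)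
  have "f c * exp (C * c) \<le> f R * exp (C * R)"
  proof (rule DERIV_nonneg_imp_increasing_open[where f = "\<lambda>r. f r * exp (C * r)"])
    show "\<exists>d. ((\<lambda>r. f r * exp (C * r)) has_real_derivative d) (at r) \<and> d \<ge> 0"
      if "c < r" "r < R" for r
    proof (intro exI conjI)
      have r: "(f has_real_derivative f' r) (at r)" "f' r \<ge> - C * f r"
        using b[of r] c that by auto
      show "((\<lambda>r. f r * exp (C * r)) has_real_derivative (f' r + C * f r) * exp (C * r)) (at r)"
        by (rule derivative_eq_intros r(1) refl)+ (simp add: algebra_simps)
      show "(f' r + C * f r) * exp (C * r) \<ge> 0" using r(2) by simp
    qed
    show "continuous_on {c..R} (\<lambda>r. f r * exp (C * r))"
      using c by (intro continuous_intros continuous_on_subset[OF assms(2)]) auto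
  qed (use c in auto)
  moreover have "f c * exp (C * c) > 0" using b[of c] c by simp
  ultimately show ?thesis by (smt (verit) exp_gt_zero zero_less_mult_iff)
qed

lemma differentiable_powr_const:
  fixes g :: "'a::real_normed_vector \<Rightarrow> real"
  assumes "g differentiable (at z)" "g z > 0"
  shows "(\<lambda>z. g z powr c) differentiable (at z)"
  using assms has_derivative_powr[OF _ has_derivative_const, of g _ z UNIV c]
  unfolding differentiable_def by blast

section \<open>Elementary properties of the particle density\<close>

lemma particle_density_0: "particle_density 0 y = 0"
  by (simp add: particle_density_def)

lemma particle_density_pos: "x > 0 \<Longrightarrow> y > 0 \<Longrightarrow> particle_density x y > 0"
  by (simp add: particle_density_def)

lemma particle_density_nonneg: "x \<ge> 0 \<Longrightarrow> y \<ge> 0 \<Longrightarrow> particle_density x y \<ge> 0"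
  by (simp add: particle_density_def)

lemma particle_density_powr_cube:
  assumes "x \<ge> 0" "y \<ge> 0"
  shows "(particle_density x y powr (2/3)) ^ 3 = x * y\<^sup>2"
proof (cases "x = 0 \<or> y = 0")
  case False
  then have n: "particle_density x y > 0" using assms by (simp add: particle_density_def)
  then have "(particle_density x y powr (2/3)) ^ 3 = particle_density x y ^ 2"
    by (simp add: powr_powr flip: powr_numeral)
  then show ?thesis using assms by (simp add: particle_density_def power_mult_distrib)
qed (auto simp: particle_density_def)

text \<open>The inequality of arithmetic and geometric means for \<open>x, y, y\<close>; after
  cubing, the difference factors with \<open>(x - y)\<^sup>2\<close>.\<close>

lemma particle_density_powr_le:
  assumes "x \<ge> 0" "y \<ge> 0"
  shows "3 * particle_density x y powr (2/3) \<le> x + 2 * y"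
proof (rule power_le_imp_le_base)
  have "(x + 2 * y) ^ 3 - 27 * (x * y\<^sup>2) = (x - y)\<^sup>2 * (x + 8 * y)" by algebra
  moreover have "\<dots> \<ge> 0" using assms by simp
  ultimately show "(3 * particle_density x y powr (2/3)) ^ Suc 2 \<le> (x + 2 * y) ^ Suc 2"
    using particle_density_powr_cube[OF assms] by (simp add: power_mult_distrib eval_nat_numeral)
qed (use assms in simp)

text \<open>The factors of \<open>\<rho>\<close> and \<open>p\<^sub>r\<^sub>a\<^sub>d\<close> besides \<open>a n\<^bsup>\<Gamma> - 2/3\<^esup>\<close>: they have no singularity at \<open>x = 0\<close>.\<close>

definition density_core :: "real \<Rightarrow> real \<Rightarrow> real \<Rightarrow> real" where
  "density_core k x y = particle_density x y powr (2/3)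
     + k * (x + 2 * y - 3 * particle_density x y powr (2/3))"

definition prad_core :: "real \<Rightarrow> real \<Rightarrow> real \<Rightarrow> real \<Rightarrow> real" where
  "prad_core k \<Gamma> x y = (\<Gamma> - 1) * density_core k x y + 4 * k * (x - y) / 3"

lemma density_core_pos:
  assumes "k > 0" "x > 0" "y > 0"
  shows "density_core k x y > 0"
  unfolding density_core_def
  by (rule add_pos_nonneg)
    (use assms particle_density_pos[of x y] particle_density_powr_le[of x y] in auto)

section \<open>Matter functions for the linear equation of state\<close>

context
  fixes \<rho>0 :: "real \<Rightarrow> real" and a \<Gamma> :: real
  assumes lin: "linear_fluid \<rho>0 a \<Gamma>"
begin

lemma fluid_density_factor:
  "n > 0 \<Longrightarrow> \<rho>0 n = a * n powr (\<Gamma> - 2/3) * n powr (2/3)"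
  using lin by (simp add: linear_fluid_def flip: powr_add)

text \<open>The factorization extends to \<open>x = 0\<close> or \<open>y = 0\<close> because
  \<open>0 powr c = 0\<close> in HOL matches the convention of zero density there.\<close>

lemma john_density_linear:
  assumes "x \<ge> 0" "y \<ge> 0"
  shows "john_density k \<rho>0 x y
    = a * particle_density x y powr (\<Gamma> - 2/3) * density_core k x y"
proof (cases "x = 0 \<or> y = 0")
  case False
  then have n: "particle_density x y > 0" using assms by (simp add: particle_density_def)
  then have "particle_density x y powr (2/3) > 0" by simp
  with False n show ?thesis
    unfolding john_density_def fluid_density_factor[OF n] density_core_def john_factor_def
    by (simp add: field_simps)
qed (auto simp: john_density_def particle_density_def)

lemma john_prad_linear:
  assumes "x \<ge> 0" "y \<ge> 0"
  shows "john_prad k \<rho>0 x y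
    = a * particle_density x y powr (\<Gamma> - 2/3) * prad_core k \<Gamma> x y"
proof (cases "x = 0 \<or> y = 0")
  case False
  then have n: "particle_density x y > 0" using assms by (simp add: particle_density_def)
  then have w: "particle_density x y powr (2/3) > 0" by simp
  have "fluid_pressure \<rho>0 (particle_density x y) = (\<Gamma> - 1) * \<rho>0 (particle_density x y)"
    using linear_fluid_pressure(2)[OF lin] n by simp
  note p = this
  from False w show ?thesis
    unfolding john_prad_def p fluid_density_factor[OF n] density_core_def prad_core_def
      john_factor_def
    by (simp add: field_simps)
qed (auto simp: john_prad_def particle_density_def)

lemma john_anisotropy_linear:
  assumes "x \<ge> 0" "y \<ge> 0"
  shows "john_ptan k \<rho>0 x y - john_prad k \<rho>0 x y
    = a * particle_density x y powr (\<Gamma> - 2/3) * (2 * k * (y - x))"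
proof (cases "x = 0 \<or> y = 0")
  case False
  then have n: "particle_density x y > 0" using assms by (simp add: particle_density_def)
  then have "particle_density x y powr (2/3) > 0" by simp
  with False n show ?thesis
    unfolding john_prad_def john_ptan_def fluid_density_factor[OF n]
    by (simp add: field_simps)
qed (auto simp: john_prad_def john_ptan_def particle_density_def)

lemma john_prad_differentiable:
  assumes "x > 0" "y > 0"
  shows "(\<lambda>z. john_prad k \<rho>0 (fst z) (snd z)) differentiable (at (x, y))"
proof -
  define g where "g = (\<lambda>z :: real \<times> real. a * particle_density (fst z) (snd z) powr (\<Gamma> - 2/3)
      * prad_core k \<Gamma> (fst z) (snd z))"
  have n: "(\<lambda>z. particle_density (fst z) (snd z)) differentiable (at (x, y))"
    unfolding differentiable_def particle_density_def
    by (rule exI, (rule derivative_eq_intros refl)+)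
      (use assms in \<open>auto intro: bounded_linear_imp_has_derivative bounded_linear_fst\<close>)
  have w: "(\<lambda>z. particle_density (fst z) (snd z) powr c) differentiable (at (x, y))" for c
    by (rule differentiable_powr_const[OF n]) (use assms particle_density_pos in auto)
  have xy: "fst differentiable (at (x, y))" "snd differentiable (at (x, y))"
    by (intro bounded_linear_imp_differentiable bounded_linear_fst bounded_linear_snd)+
  have "g differentiable (at (x, y))"
    unfolding g_def prad_core_def density_core_def divide_inverse
    by (intro differentiable_add differentiable_diff differentiable_mult differentiable_const w xy)
  then obtain D where D: "(g has_derivative D) (at (x, y))" by (auto simp: differentiable_def)
  have "((\<lambda>z. john_prad k \<rho>0 (fst z) (snd z)) has_derivative D) (at (x, y))"
    \<comment> \<open>The factored form agrees with \<open>john_prad\<close> on the open quadrant, a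
      neighbourhood of \<open>(x, y)\<close>.\<close>
    by (rule has_derivative_transform_within_open[OF D, of "{0<..} \<times> {0<..}"])
      (use assms in \<open>auto simp: g_def john_prad_linear intro!: open_Times\<close>)
  then show ?thesis by (auto simp: differentiable_def)
qed

end


section \<open>Regular ball solutions up to the boundary\<close>

locale linear_john_ball =
  fixes k a \<Gamma> R M :: real and \<rho>0 x y m :: "real \<Rightarrow> real"
  assumes k: "k > 0" and \<Gamma>: "1 < \<Gamma>" and a: "a > 0"
    and lin: "linear_fluid \<rho>0 a \<Gamma>"
    and sol: "regular_ball_solution k \<rho>0 x y m R M"
begin

definition "n r = particle_density (x r) (y r)"
definition "\<rho> r = john_density k \<rho>0 (x r) (y r)"
definition "p r = john_prad k \<rho>0 (x r) (y r)"
definition "q r = john_ptan k \<rho>0 (x r) (y r)"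
definition "p' r = - (p r + \<rho> r) * ((m r + r ^ 3 * p r / 2) / (r * (r - 2 * m r)))
  + 2 / r * (q r - p r)"

lemma R: "R > 0" and mass: "r > 0 \<Longrightarrow> 0 < 2 * m r" "r > 0 \<Longrightarrow> 2 * m r < r" and mR: "m R = M"
  and cont: "continuous_on {0..R} x" "continuous_on {0..R} y" "continuous_on {0..R} m"
  and pos: "0 \<le> r \<Longrightarrow> r < R \<Longrightarrow> x r > 0" "0 \<le> r \<Longrightarrow> r < R \<Longrightarrow> y r > 0"
  and p_pos: "0 \<le> r \<Longrightarrow> r < R \<Longrightarrow> p r > 0" and p_R: "p R = 0"
  and system: "solves_john_system k \<rho>0 x y m {0<..<R}"
  using sol by (auto simp: regular_ball_solution_def C1_closed_def p_def)

lemma at_left: "\<forall>\<^sub>F r in at_left R. 0 < r \<and> r < R"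
  using eventually_at_left_real[OF R] by simp

lemma tendsto_left:
  "continuous_on {0..R} f \<Longrightarrow> (f \<longlongrightarrow> f R) (at_left R)" for f :: "real \<Rightarrow> real"
  using continuous_on_Icc_at_leftD R by blast

lemma nonneg_R:
  fixes f :: "real \<Rightarrow> real"
  assumes "continuous_on {0..R} f" "\<And>r. 0 < r \<Longrightarrow> r < R \<Longrightarrow> f r > 0"
  shows "f R \<ge> 0"
  by (rule tendsto_lowerbound[OF tendsto_left[OF assms(1)]])
    (use at_left assms(2) in \<open>auto elim!: eventually_mono intro: less_imp_le\<close>)

lemma y_deriv:
  "0 < r \<Longrightarrow> r < R \<Longrightarrow>
    (y has_real_derivative 2 / r * (sqrt (r / (r - 2 * m r) * (x r * y r)) - y r)) (at r)"
  using system by (simp add: solves_john_system_def)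

text \<open>The second equation of the system says that \<open>(r\<^sup>2 y)' = 2 r \<surd>(r x y / (r - 2 m)) \<ge> 0\<close>.\<close>

lemma y_R_pos: "y R > 0"
proof -
  have "y (R/2) * (R/2)\<^sup>2 \<le> y R * R\<^sup>2"
  proof (rule DERIV_nonneg_imp_increasing_open[where f = "\<lambda>r. y r * r\<^sup>2"])
    show "\<exists>d. ((\<lambda>r. y r * r\<^sup>2) has_real_derivative d) (at r) \<and> d \<ge> 0"
      if "R/2 < r" "r < R" for r
    proof (intro exI conjI)
      have r: "0 < r" "r < R" using that R by auto
      show "((\<lambda>r. y r * r\<^sup>2) has_real_derivative
          2 * r * sqrt (r / (r - 2 * m r) * (x r * y r))) (at r)"
        by (rule derivative_eq_intros y_deriv[OF r] refl)+
          (use r in \<open>simp add: field_simps power2_eq_square\<close>)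
      show "2 * r * sqrt (r / (r - 2 * m r) * (x r * y r)) \<ge> 0"
        using r pos[of r] mass[of r] by simp
    qed
    show "continuous_on {R/2..R} (\<lambda>r. y r * r\<^sup>2)"
      using R by (intro continuous_intros continuous_on_subset[OF cont(2)]) auto
  qed (use R in auto)
  moreover have "y (R/2) * (R/2)\<^sup>2 > 0" using pos(2)[of "R/2"] R by simp
  ultimately show ?thesis by (smt (verit) zero_le_power2 zero_less_mult_iff)
qed

lemma nonneg: "0 \<le> r \<Longrightarrow> r \<le> R \<Longrightarrow> x r \<ge> 0" "0 \<le> r \<Longrightarrow> r \<le> R \<Longrightarrow> y r \<ge> 0"
  using pos[of r] nonneg_R[OF cont(1)] y_R_pos pos(1) by (cases "r = R"; force)+

lemma n_cont: "continuous_on {0..R} n"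
  unfolding n_def particle_density_def by (intro continuous_intros cont)

lemma n_pos: "0 \<le> r \<Longrightarrow> r < R \<Longrightarrow> n r > 0"
  by (simp add: n_def particle_density_pos pos)

text \<open>As \<open>n R\<close> may be 0, continuity at \<open>R\<close> relies on the positive
  exponent.\<close>

lemma n_powr_cont: "continuous_on {0..R} (\<lambda>r. n r powr c)" if "c > 0"
  by (rule continuous_on_powr') (use that nonneg in \<open>auto simp: n_def particle_density_nonneg
    intro!: n_cont[unfolded n_def] continuous_intros\<close>)

lemma cores_cont:
  "continuous_on {0..R} (\<lambda>r. density_core k (x r) (y r))"
  "continuous_on {0..R} (\<lambda>r. prad_core k \<Gamma> (x r) (y r))"
  unfolding prad_core_def density_core_def n_def[symmetric]
  by (intro continuous_intros cont n_powr_cont; simp)+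

lemma formulas:
  assumes "0 \<le> r" "r \<le> R"
  shows "\<rho> r = a * n r powr (\<Gamma> - 2/3) * density_core k (x r) (y r)"
    and "p r = a * n r powr (\<Gamma> - 2/3) * prad_core k \<Gamma> (x r) (y r)"
    and "q r - p r = a * n r powr (\<Gamma> - 2/3) * (2 * k * (y r - x r))"
  using assms nonneg[of r] john_density_linear[OF lin] john_prad_linear[OF lin]
    john_anisotropy_linear[OF lin] by (auto simp: n_def \<rho>_def p_def q_def)

lemma matter_cont:
  "continuous_on {0..R} \<rho>" "continuous_on {0..R} p" "continuous_on {0..R} (\<lambda>r. q r - p r)"
  by (subst continuous_on_cong[OF refl formulas(1)] continuous_on_cong[OF refl formulas(2)]
        continuous_on_cong[OF refl formulas(3)],
      simp, simp, intro continuous_intros n_powr_cont cores_cont cont, use \<Gamma> in simp)+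

lemma gravity_tendsto:
  "((\<lambda>r. (m r + r ^ 3 * p r / 2) / (r * (r - 2 * m r))) \<longlongrightarrow> M / (R * (R - 2 * M))) (at_left R)"
proof -
  have "R * (R - 2 * m R) \<noteq> 0" using R mass[OF R] by auto
  then have "((\<lambda>r. (m r + r ^ 3 * p r / 2) / (r * (r - 2 * m r)))
      \<longlongrightarrow> (m R + R ^ 3 * p R / 2) / (R * (R - 2 * m R))) (at_left R)"
    by (intro tendsto_intros tendsto_left[OF cont(3)] tendsto_left[OF matter_cont(2)]) auto
  then show ?thesis by (simp add: p_R mR)
qed

text \<open>
  Multiplied by \<open>\<partial>\<^sub>x p\<^sub>r\<^sub>a\<^sub>d\<close>, the first equation of the system is the
  Tolman-Oppenheimer-Volkoff equation for the radial pressure.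
\<close>

lemma p_deriv:
  assumes r: "0 < r" "r < R"
  shows "(p has_real_derivative p' r) (at r)"
proof -
  let ?x' = "1 / john_prad_dx k \<rho>0 (x r) (y r) * (p' r - deriv y r * john_prad_dy k \<rho>0 (x r) (y r))"
  have x: "(x has_real_derivative ?x') (at r)" and dx: "john_prad_dx k \<rho>0 (x r) (y r) \<noteq> 0"
    using system r by (auto simp: solves_john_system_def p'_def p_def q_def \<rho>_def)
  have y: "(y has_real_derivative deriv y r) (at r)"
    using y_deriv[OF r] DERIV_imp_deriv by metis
  \<comment> \<open>In the chain rule the \<open>y\<close>-terms cancel and
    \<open>john_prad_dx\<close> cancels its reciprocal, leaving \<open>p'\<close>.\<close>
  have "(p has_real_derivative ?x' * john_prad_dx k \<rho>0 (x r) (y r)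
      + deriv y r * john_prad_dy k \<rho>0 (x r) (y r)) (at r)"
    unfolding p_def[abs_def] john_prad_dx_def john_prad_dy_def
    by (rule partial_derivs_chain[OF john_prad_differentiable[OF lin]])
      (use x y pos[of r] r in \<open>auto simp: john_prad_dx_def john_prad_dy_def\<close>)
  then show ?thesis using dx by simp
qed

lemma prad_core_pos:
  assumes "0 < r" "r < R"
  shows "prad_core k \<Gamma> (x r) (y r) > 0"
proof -
  have "a * n r powr (\<Gamma> - 2/3) > 0" using n_pos[of r] a assms by simp
  then show ?thesis
    using p_pos[of r] formulas(2)[of r] assms zero_less_mult_pos by (simp del: zero_less_mult_iff)
qed

section \<open>The case of positive boundary density\<close>

lemma density_R: "\<rho> R > 0 \<longleftrightarrow> x R > 0"
proof
  assume "x R > 0"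
  then show "\<rho> R > 0"
    using formulas(1)[of R] R a density_core_pos[OF k _ y_R_pos, of "x R"]
      particle_density_pos[OF _ y_R_pos, of "x R"] by (simp add: n_def)
next
  assume "\<rho> R > 0"
  then have "x R \<noteq> 0" by (auto simp: \<rho>_def john_density_def)
  then show "x R > 0" using nonneg(1)[of R] R by simp
qed

lemma prad_core_R:
  assumes "x R > 0"
  shows "prad_core k \<Gamma> (x R) (y R) = 0"
  using formulas(2)[of R] p_R R a particle_density_pos[OF assms y_R_pos] by (simp add: n_def)

lemma k_gt:
  assumes "x R > 0" "\<Gamma> \<ge> 5/3"
  shows "k > 1/3"
proof -
  let ?w = "n R powr (2/3)"
  have w: "?w > 0" using particle_density_pos[OF assms(1) y_R_pos] by (simp add: n_def)
  \<comment> \<open>The vanishing of \<open>prad_core\<close> at \<open>R\<close>, with the terms in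
    \<open>?w\<close> isolated.\<close>
  have "(\<Gamma> - 1) * (?w * (3 * k - 1)) = k * (\<Gamma> + 1/3) * x R + 2 * k * (\<Gamma> - 5/3) * y R"
    using prad_core_R[OF assms(1)]
    by (simp add: prad_core_def density_core_def n_def[symmetric] field_simps)
  also have "\<dots> > 0"
    using assms k y_R_pos by (intro add_pos_nonneg) auto
  finally show ?thesis using \<Gamma> w by (simp add: zero_less_mult_iff)
qed

lemma mass_bound:
  assumes "x R > 0"
  shows "2 * M / R \<ge> 6 * (\<Gamma> - 1) / (6 * \<Gamma> - 5)"
proof -
  have M: "2 * M < R" using mass[OF R] mR by simp
  let ?L = "- (p R + \<rho> R) * (M / (R * (R - 2 * M))) + 2 / R * (q R - p R)"
  have lim: "(p' \<longlongrightarrow> ?L) (at_left R)"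
    unfolding p'_def[abs_def] using R
    by (intro tendsto_intros gravity_tendsto tendsto_left[OF matter_cont(1)]
        tendsto_left[OF matter_cont(2)] tendsto_left[OF matter_cont(3)]) auto
  have "?L \<le> 0"
  proof (rule ccontr)
    assume "\<not> ?L \<le> 0"
    then have "\<forall>\<^sub>F r in at_left R. p' r > 0" using order_tendstoD(1)[OF lim, of 0] by simp
    \<comment> \<open>The Gronwall estimate with \<open>C = 0\<close>: a pressure increasing near
      \<open>R\<close> could not drop to 0.\<close>
    with at_left have "\<forall>\<^sub>F r in at_left R.
        p r > 0 \<and> (p has_real_derivative p' r) (at r) \<and> p' r \<ge> - 0 * p r"
      by eventually_elim (use p_pos p_deriv in auto)
    from positive_at_right_end[OF R matter_cont(2) this] p_R show False by simp
  qed
  have anisotropy: "q R - p R = 3/2 * (\<Gamma> - 1) * \<rho> R"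
  proof -
    have "2 * k * (y R - x R) = 3/2 * (\<Gamma> - 1) * density_core k (x R) (y R)"
      using prad_core_R[OF assms] by (simp add: prad_core_def field_simps)
    then show ?thesis using formulas[of R] R by simp
  qed
  have "?L = \<rho> R / R * (3 * (\<Gamma> - 1) - M / (R - 2 * M))"
    unfolding anisotropy unfolding p_R using R M by (simp add: divide_simps) (simp add: algebra_simps)
  with \<open>?L \<le> 0\<close> have "\<rho> R / R * (3 * (\<Gamma> - 1) - M / (R - 2 * M)) \<le> 0"
    by (simp only:)
  then have "3 * (\<Gamma> - 1) \<le> M / (R - 2 * M)"
    using density_R assms R divide_pos_pos[of "\<rho> R" R] mult_pos_pos[of "\<rho> R / R"]
    by (meson diff_gt_0_iff_gt not_le)
  then have "6 * (\<Gamma> - 1) * R \<le> 2 * M * (6 * \<Gamma> - 5)"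
    using M by (simp add: field_simps)
  then show ?thesis using R \<Gamma> by (simp add: field_simps)
qed

section \<open>The degenerate case \<open>x R = 0\<close>\<close>

context
  assumes x_R: "x R = 0"
begin

lemma prad_core_R_degenerate: "prad_core k \<Gamma> (x R) (y R) = 2 * k * (\<Gamma> - 5/3) * y R"
  and density_core_R_degenerate: "density_core k (x R) (y R) = 2 * k * y R"
  by (simp_all add: prad_core_def density_core_def particle_density_0 x_R field_simps)

lemma \<Gamma>_ge: "\<Gamma> \<ge> 5/3"
  using nonneg_R[OF cores_cont(2) prad_core_pos] k y_R_pos
  by (simp add: prad_core_R_degenerate zero_le_mult_iff)

lemma k_le:
  assumes "\<Gamma> = 5/3"
  shows "k \<le> 1/3"
proof -
  \<comment> \<open>This is \<open>prad_core\<close> divided by \<open>w = n r powr (2/3)\<close>: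
    the terms in \<open>y\<close> cancel for \<Gamma> = 5/3, and
    \<open>x = w ^ 3 / y\<^sup>2\<close>.\<close>
  let ?f = "\<lambda>r. 2/3 * (1 - 3 * k) + 2 * k * ((n r powr (2/3)) / y r)\<^sup>2"
  have "(?f \<longlongrightarrow> 2/3 * (1 - 3 * k) + 2 * k * ((n R powr (2/3)) / y R)\<^sup>2) (at_left R)"
    using y_R_pos by (intro tendsto_intros tendsto_left[OF n_powr_cont] tendsto_left[OF cont(2)]) auto
  moreover have "\<forall>\<^sub>F r in at_left R. ?f r \<ge> 0"
    using at_left
  proof eventually_elim
    case (elim r)
    let ?w = "n r powr (2/3)"
    have w: "?w > 0" using n_pos[of r] elim by simp
    have "x r * (y r)\<^sup>2 = ?w ^ 3"
      using particle_density_powr_cube[of "x r" "y r"] nonneg[of r] elim by (simp add: n_def)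
    moreover define u where "u = (?w / y r)\<^sup>2"
    ultimately have "x r * (y r)\<^sup>2 = ?w * u * (y r)\<^sup>2"
      using pos[of r] elim by (simp add: field_simps power2_eq_square power3_eq_cube)
    then have "x r = ?w * u" using pos[of r] elim by simp
    then have "prad_core k \<Gamma> (x r) (y r) = ?w * ?f r"
      unfolding prad_core_def density_core_def assms n_def[symmetric] u_def[symmetric]
      by (simp add: field_simps)
    then show ?case using prad_core_pos[of r] elim w by (simp add: zero_less_mult_iff)
  qed
  ultimately have "2/3 * (1 - 3 * k) + 2 * k * ((n R powr (2/3)) / y R)\<^sup>2 \<ge> 0"
    by (rule tendsto_lowerbound) simp
  then show ?thesis by (simp add: n_def x_R particle_density_0)
qed

text \<open>
  For \<open>\<Gamma> > 5/3\<close> the ratio \<open>\<rho> / p\<close> stays bounded as \<open>x \<rightarrow> 0\<close> and the anisotropy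
  \<open>q - p\<close> is nonnegative, so that \<open>p' \<ge> - K p\<close> near the boundary and \<open>p\<close> cannot vanish there.
\<close>

lemma \<Gamma>_le: "\<Gamma> \<le> 5/3"
proof (rule ccontr)
  assume "\<not> \<Gamma> \<le> 5/3"
  then have \<Gamma>': "\<Gamma> > 5/3" by simp
  \<comment> \<open>At \<open>R\<close> the ratio of \<open>density_core\<close> to
    \<open>prad_core\<close> is \<open>1 / (\<Gamma> - 5/3)\<close>; the extra 1 gives a strict
    bound, which persists near \<open>R\<close>.\<close>
  define C where "C = 1 + 1 / (\<Gamma> - 5/3)"
  \<comment> \<open>One more than the limit of the gravitational factor \<open>g\<close> at
    \<open>R\<close>.\<close>
  define A where "A = M / (R * (R - 2 * M)) + 1"
  define g where "g r = (m r + r ^ 3 * p r / 2) / (r * (r - 2 * m r))" for r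
  have C: "C * (\<Gamma> - 5/3) = \<Gamma> - 5/3 + 1" "C > 0" using \<Gamma>' by (auto simp: C_def field_simps)
  let ?h = "\<lambda>r. density_core k (x r) (y r) - C * prad_core k \<Gamma> (x r) (y r)"
  have "?h R = 2 * k * y R * (1 - C * (\<Gamma> - 5/3))"
    by (simp add: prad_core_R_degenerate density_core_R_degenerate algebra_simps)
  also have "\<dots> < 0" using k y_R_pos \<Gamma>' by (simp add: C mult_less_0_iff)
  finally have "\<forall>\<^sub>F r in at_left R. ?h r < 0"
    by (intro order_tendstoD(2)[OF tendsto_left] continuous_intros cores_cont)
  moreover have "\<forall>\<^sub>F r in at_left R. g r < A"
    unfolding g_def by (rule order_tendstoD(2)[OF gravity_tendsto]) (simp add: A_def)
  moreover have "\<forall>\<^sub>F r in at_left R. y r - x r > 0"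
    by (intro order_tendstoD(1)[OF tendsto_left[of "\<lambda>r. y r - x r"]] continuous_intros cont)
      (simp add: x_R y_R_pos)
  ultimately have "\<forall>\<^sub>F r in at_left R. p r > 0 \<and> (p has_real_derivative p' r) (at r)
      \<and> p' r \<ge> - ((1 + C) * A) * p r"
    using at_left
  proof eventually_elim
    case (elim r)
    then have r: "0 \<le> r" "r \<le> R" and p: "p r > 0" using p_pos[of r] by auto
    have N: "a * n r powr (\<Gamma> - 2/3) > 0" using a n_pos[of r] elim by simp
    have "\<rho> r \<le> C * p r"
      using mult_left_mono[OF less_imp_le less_imp_le[OF N],
          of "density_core k (x r) (y r)" "C * prad_core k \<Gamma> (x r) (y r)"] elim
      by (simp add: formulas[OF r] mult.assoc mult.left_commute[of C])
    then have "p r + \<rho> r \<le> (1 + C) * p r" by (simp add: algebra_simps)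
    moreover have "g r \<ge> 0"
      using mass[of r] elim p unfolding g_def by (intro divide_nonneg_nonneg) auto
    ultimately have "(p r + \<rho> r) * g r \<le> (1 + C) * p r * A"
      using elim p C by (intro mult_mono) auto
    moreover have "2 / r * (q r - p r) \<ge> 0"
      unfolding formulas(3)[OF r] using elim k N
      by (intro mult_nonneg_nonneg[OF _ mult_nonneg_nonneg[OF less_imp_le]]) auto
    moreover have "p' r = - ((p r + \<rho> r) * g r) + 2 / r * (q r - p r)"
      by (simp only: p'_def g_def mult_minus_left)
    moreover have "- ((1 + C) * A) * p r = - ((1 + C) * p r * A)" by simp
    ultimately have "p' r \<ge> - ((1 + C) * A) * p r" by linarith
    then show ?case using p p_deriv[of r] elim by simp
  qed
  from positive_at_right_end[OF R matter_cont(2) this] p_R show False by simp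
qed

end

text \<open>If \<open>x R = 0\<close>, the bounds \<open>\<Gamma>_ge\<close> and
  \<open>\<Gamma>_le\<close> leave only \<Gamma> = 5/3, where \<open>k_le\<close> gives k \<le>
  1/3.\<close>

lemma x_R_pos_iff: "x R > 0 \<longleftrightarrow> \<Gamma> < 5/3 \<or> \<Gamma> \<ge> 5/3 \<and> k > 1/3"
  using k_gt \<Gamma>_ge \<Gamma>_le k_le nonneg(1)[of R] R by force

end

theorem theorem3:
  fixes k a \<Gamma> R M :: real
    and \<rho>0 x y m :: "real \<Rightarrow> real"
  assumes "k > 0"
    and "1 < \<Gamma>" and "\<Gamma> \<le> 2"
    and "a > 0"
    and "linear_fluid \<rho>0 a \<Gamma>"
    and "regular_ball_solution k \<rho>0 x y m R M"
  shows "(x R > 0 \<longleftrightarrow> john_density k \<rho>0 (x R) (y R) > 0)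
    \<and> (x R > 0 \<longleftrightarrow> (1 < \<Gamma> \<and> \<Gamma> < 5/3) \<or> (\<Gamma> \<ge> 5/3 \<and> k > 1/3))
    \<and> (john_density k \<rho>0 (x R) (y R) > 0 \<longrightarrow>
         2 * M / R \<ge> 6 * (\<Gamma> - 1) / (6 * \<Gamma> - 5))"
proof -
  interpret linear_john_ball k a \<Gamma> R M \<rho>0 x y m
    by unfold_locales (use assms in auto)
  show ?thesis
    using density_R x_R_pos_iff mass_bound \<open>1 < \<Gamma>\<close> by (auto simp: \<rho>_def)
qed

end
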